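(* Let $p,q,r,s\in\mathbb{C}$ and let $f(x)=x^{4}+px^{3}+qx^{2}+rx+s$. Define $$\begin{aligned} D={}&18p^{3}qrs-4p^{2}q^{3}s+144qr^{2}s+p^{2}q^{2}r^{2}-192prs^{2}+144p^{2}qs^{2}+18pqr^{3}-4p^{3}r^{3}-128q^{2}s^{2}\\ &+16q^{4}s-4q^{3}r^{2}-27p^{4}s^{2}-80pq^{2}rs-6p^{2}r^{2}s+256s^{3}-27r^{4},\\ L_1={}&p^{2}q^{2}-3p^{3}r-6p^{2}s-4q^{3}+14pqr+16qs-18r^{2}. \end{aligned}$$ Then: (1) $f$ has 4 distinct roots in $\mathbb{C}$ if and only if $D\neq 0$. (2) $f$ has 1 double root and 2 single roots in $\mathbb{C}$ if and only if $D=0$ and $L_1\neq 0$. (3) $f$ has 2 distinct double roots in $\mathbb{C}$ if and only if $D=0$ and $L_1=0$ and $3p^{2}-8q\neq 0$ and $p^{3}-4pq+8r=0$. (4) $f$ has 1 triple root and 1 single root in $\mathbb{C}$ if and only if $D=0$ and $L_1=0$ and $3p^{2}-8q\neq 0$ and $p^{3}-4pq+8r\neq 0$. (5) $f$ has a quadruple root in $\mathbb{C}$ if and only if $D=0$ and $L_1=0$ and $3p^{2}-8q=0$.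
   Context: A single, double, triple or quadruple root is a root of multiplicity exactly 1, 2, 3 or 4, respectively. $D$ is the discriminant of the monic quartic $f$. *)

theory Defs
  imports Complex_Main "HOL-Computational_Algebra.Polynomial"
begin

definition quartic :: "complex \<Rightarrow> complex \<Rightarrow> complex \<Rightarrow> complex \<Rightarrow> complex poly" where
  "quartic p q r s = [:s, r, q, p, 1:]"

definition quartic_D :: "complex \<Rightarrow> complex \<Rightarrow> complex \<Rightarrow> complex \<Rightarrow> complex" where
  "quartic_D p q r s =
     18*p^3*q*r*s - 4*p^2*q^3*s + 144*q*r^2*s + p^2*q^2*r^2 - 192*p*r*s^2
     + 144*p^2*q*s^2 + 18*p*q*r^3 - 4*p^3*r^3 - 128*q^2*s^2
     + 16*q^4*s - 4*q^3*r^2 - 27*p^4*s^2 - 80*p*q^2*r*s - 6*p^2*r^2*s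
     + 256*s^3 - 27*r^4"

definition quartic_L1 :: "complex \<Rightarrow> complex \<Rightarrow> complex \<Rightarrow> complex \<Rightarrow> complex" where
  "quartic_L1 p q r s =
     p^2*q^2 - 3*p^3*r - 6*p^2*s - 4*q^3 + 14*p*q*r + 16*q*s - 18*r^2"

definition roots_of_mult :: "complex poly \<Rightarrow> nat \<Rightarrow> complex set" where
  "roots_of_mult f m = {x. poly f x = 0 \<and> order x f = m}"

end

theory Submission
  imports Defs "HOL-Computational_Algebra.Fundamental_Theorem_Algebra"
begin

text \<open>
  By the fundamental theorem of algebra the quartic has exactly four roots \<open>a, b, c, d\<close>,
  counted with multiplicity, and its coefficients are their elementary symmetric functions.
  Each of the four expressions in the classification then becomes a symmetric function of the
  roots, expressed through their differences:

  \<^item> \<open>D\<close> is the product of all squared differences, so it vanishes iff two roots coincide;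
  \<^item> \<open>2 * L\<^sub>1\<close> is the sum, over the four triples of roots, of the discriminant of the triple.
    If \<open>a = b\<close>, two of these discriminants vanish and the other two are both that of
    \<open>a, c, d\<close>; so once \<open>D = 0\<close>, \<open>L\<^sub>1\<close> vanishes iff at most two distinct roots remain;
  \<^item> \<open>3p\<^sup>2 - 8q\<close> is the sum of all squared differences. For complex roots this sum can vanish
    by cancellation, but with at most two distinct roots it is a positive multiple of the
    square of their difference, so there it detects a quadruple root;
  \<^item> \<open>p\<^sup>3 - 4pq + 8r\<close> is, up to sign, the product of the three differences of pair sums
    \<open>(a + b) - (c + d)\<close>, \<open>(a + c) - (b + d)\<close>, \<open>(a + d) - (b + c)\<close>. It vanishes on \<open>a, a, b, b\<close>,
    and on \<open>a, a, a, b\<close> it equals \<open>(a - b)\<^sup>3\<close>; this separates the two shapes with two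
    distinct roots.

  The five statements follow by evaluating these expressions on each of the five partitions
  of 4, which are all the possible shapes of the multiset of roots (\<open>size_4_cases\<close>).
\<close>

lemma quartic_nonzero: "quartic p q r s \<noteq> 0"
  by (simp add: quartic_def)

lemma roots_of_mult_eq_proots:
  assumes "f \<noteq> 0"
  shows "roots_of_mult f m = {x \<in> set_mset (proots f). count (proots f) x = m}"
  using assms by (auto simp: roots_of_mult_def)

text \<open>
  Fixing a canonical order of the four elements here replaces every later appeal to the symmetry of the root expressions.
\<close>

lemma size_4_cases:
  assumes "size M = 4"
  obtains
    (aaaa) a where "M = {#a, a, a, a#}"
  | (aaab) a b where "M = {#a, a, a, b#}" "a \<noteq> b"
  | (aabb) a b where "M = {#a, a, b, b#}" "a \<noteq> b"
  | (aabc) a b c where "M = {#a, a, b, c#}" "a \<noteq> b" "a \<noteq> c" "b \<noteq> c"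
  | (abcd) a b c d where "M = {#a, b, c, d#}" "distinct [a, b, c, d]"
proof -
  from assms obtain xs where "mset xs = M" "length xs = 4"
    by (metis ex_mset size_mset)
  then obtain a b c d where M: "M = {#a, b, c, d#}"
    by (auto simp: numeral_eq_Suc length_Suc_conv)
  show thesis
  proof (cases "distinct [a, b, c, d]")
    case True
    with M abcd show ?thesis by blast
  next
    case False
    \<comment> \<open>Bring a repeated element to the front; what remains is how the other two compare with it.\<close>
    then have "M = {#a, a, c, d#} \<or> M = {#a, a, b, d#} \<or> M = {#a, a, b, c#}
        \<or> M = {#b, b, a, d#} \<or> M = {#b, b, a, c#} \<or> M = {#c, c, a, b#}"
      unfolding M by (auto simp: add_mset_commute)
    then obtain x y z where xyz: "M = {#x, x, y, z#}" by blast
    consider "y = x" "z = x" | "y = x" "z \<noteq> x" | "y \<noteq> x" "z = x" | "y \<noteq> x" "z = y"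
      | "x \<noteq> y" "x \<noteq> z" "y \<noteq> z" by blast
    then show ?thesis
    proof cases
      case 3
      with xyz have "M = {#x, x, x, y#}" by (simp add: add_mset_commute)
      with 3 aaab show ?thesis by blast
    qed (use xyz aaaa aaab aabb aabc in blast)+
  qed
qed

text \<open>Vieta's formulas, from comparing coefficients in the factorization into linear factors.\<close>

lemma quartic_coeffs_of_proots:
  assumes "proots (quartic p q r s) = {#a, b, c, d#}"
  shows "p = -(a+b+c+d)" "q = a*b+a*c+a*d+b*c+b*d+c*d"
    "r = -(a*b*c+a*b*d+a*c*d+b*c*d)" "s = a*b*c*d"
proof -
  have "quartic p q r s = smult (lead_coeff (quartic p q r s)) (\<Prod>x\<in>#{#a, b, c, d#}. [:-x, 1:])"
    using complex_poly_decompose_multiset[of "quartic p q r s"] assms by simp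
  also have "lead_coeff (quartic p q r s) = 1"
    by (simp add: quartic_def)
  finally have eq: "[:s, r, q, p, 1:] = (\<Prod>x\<in>#{#a, b, c, d#}. [:-x, 1:])"
    by (simp add: quartic_def)
  show "p = -(a+b+c+d)" "q = a*b+a*c+a*d+b*c+b*d+c*d"
    "r = -(a*b*c+a*b*d+a*c*d+b*c*d)" "s = a*b*c*d"
    using eq by (simp_all add: algebra_simps)
qed

context
  fixes p q r s a b c d :: complex
  assumes roots: "proots (quartic p q r s) = {#a, b, c, d#}"
begin

lemma quartic_D_eq_roots:
  "quartic_D p q r s = ((a-b)*(a-c)*(a-d)*(b-c)*(b-d)*(c-d))^2"
  unfolding quartic_D_def quartic_coeffs_of_proots[OF roots] by algebra

text \<open>
  The factor 2 keeps the identity free of fractions: \<open>L\<^sub>1\<close> is half the sum of the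
  four triple discriminants.
\<close>

lemma quartic_L1_eq_roots:
  "2 * quartic_L1 p q r s = ((a-b)*(a-c)*(b-c))^2 + ((a-b)*(a-d)*(b-d))^2
     + ((a-c)*(a-d)*(c-d))^2 + ((b-c)*(b-d)*(c-d))^2"
  unfolding quartic_L1_def quartic_coeffs_of_proots[OF roots] by algebra

lemma sum_squared_diffs_eq_roots:
  "3*p^2 - 8*q = (a-b)^2 + (a-c)^2 + (a-d)^2 + (b-c)^2 + (b-d)^2 + (c-d)^2"
  unfolding quartic_coeffs_of_proots[OF roots] by algebra

lemma pairings_eq_roots:
  "p^3 - 4*p*q + 8*r = -((a+b-c-d)*(a+c-b-d)*(a+d-b-c))"
  unfolding quartic_coeffs_of_proots[OF roots] by algebra

end

theorem mainTheorem4: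
  fixes p q r s :: complex
  shows
    "(card {x. poly (quartic p q r s) x = 0} = 4 \<longleftrightarrow> quartic_D p q r s \<noteq> 0) \<and>
     (card (roots_of_mult (quartic p q r s) 2) = 1 \<and> card (roots_of_mult (quartic p q r s) 1) = 2
        \<longleftrightarrow> quartic_D p q r s = 0 \<and> quartic_L1 p q r s \<noteq> 0) \<and>
     (card (roots_of_mult (quartic p q r s) 2) = 2
        \<longleftrightarrow> quartic_D p q r s = 0 \<and> quartic_L1 p q r s = 0 \<and>
            3*p^2 - 8*q \<noteq> 0 \<and> p^3 - 4*p*q + 8*r = 0) \<and>
     (card (roots_of_mult (quartic p q r s) 3) = 1 \<and> card (roots_of_mult (quartic p q r s) 1) = 1
        \<longleftrightarrow> quartic_D p q r s = 0 \<and> quartic_L1 p q r s = 0 \<and>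
            3*p^2 - 8*q \<noteq> 0 \<and> p^3 - 4*p*q + 8*r \<noteq> 0) \<and>
     ((\<exists>x. x \<in> roots_of_mult (quartic p q r s) 4)
        \<longleftrightarrow> quartic_D p q r s = 0 \<and> quartic_L1 p q r s = 0 \<and> 3*p^2 - 8*q = 0)"
proof -
  define M where "M = proots (quartic p q r s)"
  have size_M: "size M = 4"
    by (simp add: M_def size_proots_complex quartic_def)
  have roots: "{x. poly (quartic p q r s) x = 0} = set_mset M"
    by (simp add: M_def quartic_nonzero)
  have mult: "roots_of_mult (quartic p q r s) m = {x \<in> set_mset M. count M x = m}" for m
    by (simp add: M_def roots_of_mult_eq_proots quartic_nonzero)
  note invariants = quartic_D_eq_roots quartic_L1_eq_roots
    sum_squared_diffs_eq_roots pairings_eq_roots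
  \<comment> \<open>Puts every occurrence of \<open>L\<^sub>1\<close> into the form in which the root expression is known.\<close>
  have L1_eq_0_iff: "quartic_L1 p q r s = 0 \<longleftrightarrow> 2 * quartic_L1 p q r s = 0"
    by simp
  from size_M show ?thesis
  proof (cases rule: size_4_cases)
    case (aaaa a)
    have "{x \<in> set_mset M. count M x = m} = (if m = 4 then {a} else {})" for m
      using aaaa by auto
    moreover have "card (set_mset M) = 1"
      using aaaa by simp
    ultimately show ?thesis
      unfolding roots L1_eq_0_iff invariants[OF aaaa[unfolded M_def]] by (simp add: mult)
  next
    case (aaab a b)
    have "{x \<in> set_mset M. count M x = m} = (if m = 3 then {a} else if m = 1 then {b} else {})" for m
      using aaab by auto
    moreover have "card (set_mset M) = 2"
      using aaab by simp
    ultimately show ?thesis using aaab(2)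
      unfolding roots L1_eq_0_iff invariants[OF aaab(1)[unfolded M_def]] by (simp add: mult)
  next
    case (aabb a b)
    have "{x \<in> set_mset M. count M x = m} = (if m = 2 then {a, b} else {})" for m
      using aabb by auto
    moreover have "card (set_mset M) = 2"
      using aabb by simp
    ultimately show ?thesis using aabb(2)
      unfolding roots L1_eq_0_iff invariants[OF aabb(1)[unfolded M_def]] by (simp add: mult)
  next
    case (aabc a b c)
    have "{x \<in> set_mset M. count M x = m} = (if m = 2 then {a} else if m = 1 then {b, c} else {})" for m
      using aabc by auto
    moreover have "card (set_mset M) = 3"
      using aabc by simp
    ultimately show ?thesis using aabc(2-)
      unfolding roots L1_eq_0_iff invariants[OF aabc(1)[unfolded M_def]] by (simp add: mult)
  next
    case (abcd a b c d)
    have "{x \<in> set_mset M. count M x = m} = (if m = 1 then {a, b, c, d} else {})" for m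
      using abcd by auto
    moreover have "card (set_mset M) = 4"
      using abcd by simp
    ultimately show ?thesis using abcd(2)
      unfolding roots L1_eq_0_iff invariants[OF abcd(1)[unfolded M_def]] by (simp add: mult)
  qed
qed

end
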